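(* Let $\eta_i=\eta_i(R^i)$, $i=1,\dots,n$, be functions of one variable each, with $\eta_i(R^i)\neq\eta_j(R^j)$ for $i\ne j$, and let $\beta_{ij}(R^1,\dots,R^n)$, $i\neq j$, be functions. Consider the nonlinear system $$\partial_k\beta_{ij}=\beta_{ik}\beta_{kj}\quad(i,j,k\text{ pairwise distinct}),$$ $$\partial_i\beta_{ij}=\frac12\frac{\eta_i'}{\eta_j-\eta_i}\beta_{ij}+\frac12\frac{\eta_j'}{\eta_j-\eta_i}\beta_{ji}+\sum_{k\neq i,j}\frac{\eta_k-\eta_j}{\eta_j-\eta_i}\beta_{ki}\beta_{kj}\quad(i\neq j).$$ This system possesses the following Lax pair with spectral parameter $\lambda$: it is the compatibility condition (for all $\lambda$) of the linear system for $\psi_1,\dots,\psi_n$ $$\partial_j\psi_i=\beta_{ij}\psi_j\ (j\neq i),\qquad \partial_i\psi_i=-\frac{\eta_i'}{2(\lambda+\eta_i)}\psi_i-\sum_{k\neq i}\frac{\lambda+\eta_k}{\lambda+\eta_i}\beta_{ki}\psi_k .$$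
   Context: Here $\partial_i=\partial/\partial R^i$, $\eta_i'=d\eta_i/dR^i$, and there is no summation over repeated indices except where a sum is written. The linear system is considered where $\lambda+\eta_i\neq0$ for all $i$. "Compatibility condition (for all $\lambda$)" means: the cross-derivative identities $\partial_k(\partial_j\psi_i)=\partial_j(\partial_k\psi_i)$, computed by using the linear system, hold identically in $\psi_1,\dots,\psi_n$ for all $\lambda$ if and only if the functions $\beta_{ij}$ satisfy the nonlinear system. *)

theory Defs
  imports "HOL-Analysis.Analysis"
begin

text \<open>
  The coordinates $R^1,\dots,R^n$ are real and indexed by a finite type \<open>'n\<close>. All functions, the
  wave functions $\psi_i$ and the spectral parameter take values in a real normed field \<open>'b\<close>, so
  that \<open>'b = real\<close> and \<open>'b = complex\<close> (in particular a complex spectral parameter) are both covered.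
  Only the off-diagonal \<open>\<beta> i j\<close> with \<open>i \<noteq> j\<close> are ever used.
\<close>

definition partial_deriv :: "'n::finite \<Rightarrow> (real^'n \<Rightarrow> 'b::real_normed_field) \<Rightarrow> real^'n \<Rightarrow> 'b"
  where "partial_deriv k f R = vector_derivative (\<lambda>t. f (R + t *\<^sub>R axis k 1)) (at 0)"

definition nonlinear_system ::
    "(real^'n::finite) set \<Rightarrow> ('n \<Rightarrow> real \<Rightarrow> 'b::real_normed_field) \<Rightarrow>
      ('n \<Rightarrow> 'n \<Rightarrow> real^'n \<Rightarrow> 'b) \<Rightarrow> bool"
  where "nonlinear_system U \<eta> \<beta> \<longleftrightarrow>
    (\<forall>R\<in>U.
      (\<forall>i j k. i \<noteq> j \<and> j \<noteq> k \<and> i \<noteq> k \<longrightarrow>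
        partial_deriv k (\<beta> i j) R = \<beta> i k R * \<beta> k j R) \<and>
      (\<forall>i j. i \<noteq> j \<longrightarrow>
        partial_deriv i (\<beta> i j) R =
          1/2 * (vector_derivative (\<eta> i) (at (R $ i)) / (\<eta> j (R $ j) - \<eta> i (R $ i))) * \<beta> i j R
          + 1/2 * (vector_derivative (\<eta> j) (at (R $ j)) / (\<eta> j (R $ j) - \<eta> i (R $ i))) * \<beta> j i R
          + (\<Sum>k\<in>UNIV - {i, j}. (\<eta> k (R $ k) - \<eta> j (R $ j)) / (\<eta> j (R $ j) - \<eta> i (R $ i))
                * \<beta> k i R * \<beta> k j R)))"

text \<open>
  \<open>lax_rhs \<eta> \<beta> lam j i R \<psi>\<close> is the right-hand side of the linear equation
  $\partial_j\psi_i = \dots$, with \<open>\<psi>\<close> standing for the values of $\psi_1,\dots,\psi_n$ at \<open>R\<close>.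
\<close>

definition lax_rhs ::
    "('n::finite \<Rightarrow> real \<Rightarrow> 'b::real_normed_field) \<Rightarrow> ('n \<Rightarrow> 'n \<Rightarrow> real^'n \<Rightarrow> 'b) \<Rightarrow> 'b \<Rightarrow>
      'n \<Rightarrow> 'n \<Rightarrow> real^'n \<Rightarrow> ('n \<Rightarrow> 'b) \<Rightarrow> 'b"
  where "lax_rhs \<eta> \<beta> lam j i R \<psi> =
    (if j \<noteq> i then \<beta> i j R * \<psi> j
     else - (vector_derivative (\<eta> i) (at (R $ i)) / (2 * (lam + \<eta> i (R $ i)))) * \<psi> i
          - (\<Sum>k\<in>UNIV - {i}. (lam + \<eta> k (R $ k)) / (lam + \<eta> i (R $ i)) * \<beta> k i R * \<psi> k))"

text \<open>
  The derivative $\partial_k$ of an expression \<open>G R \<psi>\<close>, computed by the chain rule with every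
  $\partial_k\psi_m$ replaced by the right-hand side of the linear system.
\<close>

definition total_deriv ::
    "('n::finite \<Rightarrow> real \<Rightarrow> 'b::real_normed_field) \<Rightarrow> ('n \<Rightarrow> 'n \<Rightarrow> real^'n \<Rightarrow> 'b) \<Rightarrow> 'b \<Rightarrow>
      'n \<Rightarrow> (real^'n \<Rightarrow> ('n \<Rightarrow> 'b) \<Rightarrow> 'b) \<Rightarrow> real^'n \<Rightarrow> ('n \<Rightarrow> 'b) \<Rightarrow> 'b"
  where "total_deriv \<eta> \<beta> lam k G R \<psi> =
    partial_deriv k (\<lambda>S. G S \<psi>) R
    + (\<Sum>m\<in>UNIV. deriv (\<lambda>s. G R (\<psi>(m := s))) (\<psi> m) * lax_rhs \<eta> \<beta> lam k m R \<psi>)"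

definition lax_compatible ::
    "(real^'n::finite) set \<Rightarrow> ('n \<Rightarrow> real \<Rightarrow> 'b::real_normed_field) \<Rightarrow>
      ('n \<Rightarrow> 'n \<Rightarrow> real^'n \<Rightarrow> 'b) \<Rightarrow> bool"
  where "lax_compatible U \<eta> \<beta> \<longleftrightarrow>
    (\<forall>lam. \<forall>R\<in>U. (\<forall>i. lam + \<eta> i (R $ i) \<noteq> 0) \<longrightarrow>
      (\<forall>\<psi> i j k. total_deriv \<eta> \<beta> lam k (lax_rhs \<eta> \<beta> lam j i) R \<psi>
               = total_deriv \<eta> \<beta> lam j (lax_rhs \<eta> \<beta> lam k i) R \<psi>))"

end

theory Submission imports Defs begin

text \<open>
  The right-hand sides of the linear system are linear in \<open>\<psi>\<close>, so differentiating one of them along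
  the system (\<open>total_deriv_lax_rhs\<close>) differentiates the coefficients and substitutes the system for
  \<open>\<psi>\<close>. Fix \<open>R\<close> and \<open>\<lambda>\<close>, and write $c_k = \lambda + \eta_k$.

  For distinct \<open>i, j, k\<close> the identity $\partial_k(\beta_{ij}\psi_j) = \partial_j(\beta_{ik}\psi_k)$
  has the two coefficients $\partial_k\beta_{ij} - \beta_{ik}\beta_{kj}$ and its mirror image, so it
  is the first half of the nonlinear system, whatever \<open>\<lambda>\<close> is. The remaining identities compare
  $\partial_i(\partial_j\psi_i)$ with $\partial_j(\partial_i\psi_i)$ for \<open>i \<noteq> j\<close>. After multiplication
  by $c_i$, the coefficients of $\psi_k$ with \<open>k \<noteq> i, j\<close> again contain the first half, the coefficient
  of $\psi_i$ cancels, and that of $\psi_j$ is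
  \[ c_i\,\partial_i\beta_{ij} + c_j\,\partial_j\beta_{ji} + \frac12\eta_i'\beta_{ij}
     + \frac12\eta_j'\beta_{ji} + \sum_{k\neq i,j} c_k\beta_{ki}\beta_{kj}, \]
  called \<open>lax_defect\<close> below (\<open>mixed_difference\<close>). This is an affine function of \<open>\<lambda>\<close>. Admissible
  values of \<open>\<lambda>\<close> abound, since only finitely many are excluded, so it vanishes for all of them iff both
  its coefficients vanish. These are two linear equations for $\partial_i\beta_{ij}$ and
  $\partial_j\beta_{ji}$ with determinant $\eta_j - \eta_i \neq 0$, and their solution is the second
  half of the nonlinear system for the pairs \<open>(i, j)\<close> and \<open>(j, i)\<close> (\<open>affine_vanishes_iff\<close>).

  Since $\eta_i'$ is only ever differentiated in directions other than \<open>i\<close>, in which it is constant,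
  one derivative of \<open>\<eta>\<close> is enough.
\<close>

section \<open>Differentiation along coordinate lines\<close>

lemma has_partial_deriv:
  fixes f :: "real^'n::finite \<Rightarrow> 'b::real_normed_field"
  assumes "f differentiable (at R)"
  shows "((\<lambda>t. f (R + t *\<^sub>R axis k 1)) has_vector_derivative partial_deriv k f R) (at 0)"
proof -
  have "(\<lambda>t. R + t *\<^sub>R axis k 1) differentiable (at (0::real))"
    by simp
  then have "(f \<circ> (\<lambda>t. R + t *\<^sub>R axis k 1)) differentiable (at (0::real))"
    by (rule differentiable_chain_at) (use assms in simp)
  then show ?thesis
    by (simp add: partial_deriv_def o_def vector_derivative_works)
qed

lemma has_partial_deriv_coordinate:
  fixes e :: "real \<Rightarrow> 'b::real_normed_field" and R :: "real^'n::finite"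
  assumes "e differentiable (at (R $ i))"
  shows "((\<lambda>t. e ((R + t *\<^sub>R axis k 1) $ i)) has_vector_derivative
    (if k = i then vector_derivative e (at (R $ i)) else 0)) (at 0)"
proof (cases "k = i")
  case True
  have "((\<lambda>t. R $ i + t) has_vector_derivative 1) (at (0::real))"
    by (auto intro!: derivative_eq_intros)
  moreover have "(e has_vector_derivative vector_derivative e (at (R $ i))) (at (R $ i + 0))"
    using assms by (simp add: vector_derivative_works)
  ultimately have "((e \<circ> (\<lambda>t. R $ i + t)) has_vector_derivative
      1 *\<^sub>R vector_derivative e (at (R $ i))) (at 0)"
    by (rule vector_diff_chain_at)
  then show ?thesis
    using True by (simp add: o_def)
next
  case False
  then show ?thesis
    by (simp add: axis_def)
qed

lemma partial_deriv_lax_rhs_off: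
  assumes "i \<noteq> j" and "\<beta> i j differentiable (at R)"
  shows "partial_deriv k (\<lambda>S. lax_rhs \<eta> \<beta> lam j i S \<psi>) R = partial_deriv k (\<beta> i j) R * \<psi> j"
proof -
  have "((\<lambda>t. \<beta> i j (R + t *\<^sub>R axis k 1) * \<psi> j) has_vector_derivative
      partial_deriv k (\<beta> i j) R * \<psi> j) (at 0)"
    by (intro has_vector_derivative_mult_left has_partial_deriv assms)
  from vector_derivative_at[OF this] show ?thesis
    unfolding partial_deriv_def[of k "\<lambda>S. lax_rhs \<eta> \<beta> lam j i S \<psi>"]
    unfolding lax_rhs_def
    using assms(1) by simp
qed

lemma partial_deriv_lax_rhs_diag:
  fixes \<eta> :: "'n::finite \<Rightarrow> real \<Rightarrow> 'b::real_normed_field"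
  assumes "i \<noteq> j"
    and \<eta>: "\<And>m. \<eta> m differentiable (at (R $ m))"
    and \<beta>: "\<And>m. m \<noteq> i \<Longrightarrow> \<beta> m i differentiable (at R)"
  shows "partial_deriv j (\<lambda>S. lax_rhs \<eta> \<beta> lam i i S \<psi>) R =
    - (\<Sum>m\<in>UNIV - {i}. ((if j = m then vector_derivative (\<eta> m) (at (R $ m)) else 0) * \<beta> m i R
        + (lam + \<eta> m (R $ m)) * partial_deriv j (\<beta> m i) R) / (lam + \<eta> i (R $ i)) * \<psi> m)"
proof -
  have fixed: "(R + t *\<^sub>R axis j 1) $ i = R $ i" for t :: real
    using \<open>i \<noteq> j\<close> by (simp add: axis_def)
  have "((\<lambda>t. (lam + \<eta> m ((R + t *\<^sub>R axis j 1) $ m)) * \<beta> m i (R + t *\<^sub>R axis j 1)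
        / (lam + \<eta> i (R $ i)) * \<psi> m)
      has_vector_derivative
      ((if j = m then vector_derivative (\<eta> m) (at (R $ m)) else 0) * \<beta> m i R
        + (lam + \<eta> m (R $ m)) * partial_deriv j (\<beta> m i) R) / (lam + \<eta> i (R $ i)) * \<psi> m) (at 0)"
    if "m \<noteq> i" for m
  proof -
    have c: "((\<lambda>t. lam + \<eta> m ((R + t *\<^sub>R axis j 1) $ m)) has_vector_derivative
        0 + (if j = m then vector_derivative (\<eta> m) (at (R $ m)) else 0)) (at 0)"
      by (intro has_vector_derivative_add has_vector_derivative_const
          has_partial_deriv_coordinate \<eta>)
    have "((\<lambda>t. (lam + \<eta> m ((R + t *\<^sub>R axis j 1) $ m)) * \<beta> m i (R + t *\<^sub>R axis j 1))
        has_vector_derivative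
        (lam + \<eta> m ((R + 0 *\<^sub>R axis j 1) $ m)) * partial_deriv j (\<beta> m i) R
        + (0 + (if j = m then vector_derivative (\<eta> m) (at (R $ m)) else 0))
          * \<beta> m i (R + 0 *\<^sub>R axis j 1)) (at 0)"
      by (rule has_vector_derivative_mult[OF c has_partial_deriv[OF \<beta>[OF that]]])
    then have "((\<lambda>t. (lam + \<eta> m ((R + t *\<^sub>R axis j 1) $ m)) * \<beta> m i (R + t *\<^sub>R axis j 1)
          * (\<psi> m / (lam + \<eta> i (R $ i))))
        has_vector_derivative
        ((lam + \<eta> m ((R + 0 *\<^sub>R axis j 1) $ m)) * partial_deriv j (\<beta> m i) R
        + (0 + (if j = m then vector_derivative (\<eta> m) (at (R $ m)) else 0))
          * \<beta> m i (R + 0 *\<^sub>R axis j 1)) * (\<psi> m / (lam + \<eta> i (R $ i)))) (at 0)"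
      by (rule has_vector_derivative_mult_left)
    then show ?thesis
      by (simp add: add.commute)
  qed
  then have "((\<lambda>t. - (vector_derivative (\<eta> i) (at (R $ i)) / (2 * (lam + \<eta> i (R $ i)))) * \<psi> i
        - (\<Sum>m\<in>UNIV - {i}. (lam + \<eta> m ((R + t *\<^sub>R axis j 1) $ m)) * \<beta> m i (R + t *\<^sub>R axis j 1)
            / (lam + \<eta> i (R $ i)) * \<psi> m))
      has_vector_derivative
      0 - (\<Sum>m\<in>UNIV - {i}. ((if j = m then vector_derivative (\<eta> m) (at (R $ m)) else 0) * \<beta> m i R
        + (lam + \<eta> m (R $ m)) * partial_deriv j (\<beta> m i) R) / (lam + \<eta> i (R $ i)) * \<psi> m)) (at 0)"
    by (intro has_vector_derivative_diff has_vector_derivative_const has_vector_derivative_sum) auto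
  from vector_derivative_at[OF this] show ?thesis
    unfolding partial_deriv_def[of j "\<lambda>S. lax_rhs \<eta> \<beta> lam i i S \<psi>"]
    unfolding lax_rhs_def
    by (simp only: fixed) (simp add: mult_ac)
qed

section \<open>The cross-derivatives\<close>

lemma lax_rhs_linear:
  fixes \<eta> :: "'n::finite \<Rightarrow> real \<Rightarrow> 'b::real_normed_field"
  obtains A where "\<And>\<psi>. lax_rhs \<eta> \<beta> lam j i R \<psi> = (\<Sum>m\<in>UNIV. A m * \<psi> m)"
proof (cases "j = i")
  case False
  have "lax_rhs \<eta> \<beta> lam j i R \<psi> = (\<Sum>m\<in>UNIV. (if m = j then \<beta> i j R else 0) * \<psi> m)" for \<psi>
    using False by (simp add: lax_rhs_def if_distrib[of "\<lambda>x. x * _"] cong: if_cong)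
  then show ?thesis
    by (rule that)
next
  case True
  define A where "A m = (if m = i then - (vector_derivative (\<eta> i) (at (R $ i)) / (2 * (lam + \<eta> i (R $ i))))
    else - ((lam + \<eta> m (R $ m)) / (lam + \<eta> i (R $ i)) * \<beta> m i R))" for m
  have "lax_rhs \<eta> \<beta> lam j i R \<psi> = (\<Sum>m\<in>UNIV. A m * \<psi> m)" for \<psi>
  proof -
    have "(\<Sum>m\<in>UNIV. A m * \<psi> m) = A i * \<psi> i + (\<Sum>m\<in>UNIV - {i}. A m * \<psi> m)"
      by (simp add: sum.remove)
    also have "(\<Sum>m\<in>UNIV - {i}. A m * \<psi> m) =
        (\<Sum>m\<in>UNIV - {i}. - ((lam + \<eta> m (R $ m)) / (lam + \<eta> i (R $ i)) * \<beta> m i R * \<psi> m))"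
      by (rule sum.cong) (auto simp: A_def)
    finally show ?thesis
      using True by (simp add: lax_rhs_def A_def sum_negf)
  qed
  then show ?thesis
    by (rule that)
qed

text \<open>
  For an expression linear in \<open>\<psi>\<close>, the second term of the chain rule is the expression itself,
  evaluated at the derivatives of the \<open>\<psi> m\<close>.
\<close>

lemma total_deriv_lax_rhs:
  fixes \<eta> :: "'n::finite \<Rightarrow> real \<Rightarrow> 'b::real_normed_field"
  shows "total_deriv \<eta> \<beta> lam k (lax_rhs \<eta> \<beta> lam j i) R \<psi> =
    partial_deriv k (\<lambda>S. lax_rhs \<eta> \<beta> lam j i S \<psi>) R
    + lax_rhs \<eta> \<beta> lam j i R (\<lambda>m. lax_rhs \<eta> \<beta> lam k m R \<psi>)"
proof -
  obtain A where A: "\<And>\<psi>. lax_rhs \<eta> \<beta> lam j i R \<psi> = (\<Sum>m\<in>UNIV. A m * \<psi> m)"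
    using lax_rhs_linear[of \<eta> \<beta> lam j i R] by blast
  have "deriv (\<lambda>s. lax_rhs \<eta> \<beta> lam j i R (\<psi>(m := s))) (\<psi> m) = A m" for m
  proof -
    have "(\<Sum>l\<in>UNIV. A l * (\<psi>(m := s)) l) = A m * s + (\<Sum>l\<in>UNIV - {m}. A l * \<psi> l)" for s
      by (simp add: sum.remove[of UNIV m])
    moreover have "((\<lambda>s. A m * s + (\<Sum>l\<in>UNIV - {m}. A l * \<psi> l)) has_field_derivative A m) (at (\<psi> m))"
      by (auto intro!: derivative_eq_intros)
    ultimately show ?thesis
      unfolding A by (simp only: DERIV_imp_deriv)
  qed
  then show ?thesis
    by (simp add: total_deriv_def A)
qed

lemma triple_difference:
  fixes \<eta> :: "'n::finite \<Rightarrow> real \<Rightarrow> 'b::real_normed_field"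
  assumes "i \<noteq> j" "j \<noteq> k" "i \<noteq> k"
    and "\<beta> i j differentiable (at R)" "\<beta> i k differentiable (at R)"
  shows "total_deriv \<eta> \<beta> lam k (lax_rhs \<eta> \<beta> lam j i) R \<psi>
      - total_deriv \<eta> \<beta> lam j (lax_rhs \<eta> \<beta> lam k i) R \<psi> =
    (partial_deriv k (\<beta> i j) R - \<beta> i k R * \<beta> k j R) * \<psi> j
    - (partial_deriv j (\<beta> i k) R - \<beta> i j R * \<beta> j k R) * \<psi> k"
  using assms by (simp add: total_deriv_lax_rhs partial_deriv_lax_rhs_off)
    (simp add: lax_rhs_def algebra_simps)

definition lax_defect ::
    "('n::finite \<Rightarrow> real \<Rightarrow> 'b::real_normed_field) \<Rightarrow> ('n \<Rightarrow> 'n \<Rightarrow> real^'n \<Rightarrow> 'b) \<Rightarrow> 'b \<Rightarrow>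
      'n \<Rightarrow> 'n \<Rightarrow> real^'n \<Rightarrow> 'b"
  where "lax_defect \<eta> \<beta> lam i j R =
    (lam + \<eta> i (R $ i)) * partial_deriv i (\<beta> i j) R
    + (lam + \<eta> j (R $ j)) * partial_deriv j (\<beta> j i) R
    + (vector_derivative (\<eta> i) (at (R $ i)) * \<beta> i j R
       + vector_derivative (\<eta> j) (at (R $ j)) * \<beta> j i R) / 2
    + (\<Sum>k\<in>UNIV - {i, j}. (lam + \<eta> k (R $ k)) * (\<beta> k i R * \<beta> k j R))"

lemma mixed_difference:
  fixes \<eta> :: "'n::finite \<Rightarrow> real \<Rightarrow> 'b::real_normed_field"
  assumes "i \<noteq> j"
    and \<eta>: "\<And>m. \<eta> m differentiable (at (R $ m))"
    and \<beta>: "\<And>m l. m \<noteq> l \<Longrightarrow> \<beta> m l differentiable (at R)"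
    and adm: "\<And>m. lam + \<eta> m (R $ m) \<noteq> 0"
  shows "(lam + \<eta> i (R $ i)) *
      (total_deriv \<eta> \<beta> lam i (lax_rhs \<eta> \<beta> lam j i) R \<psi>
       - total_deriv \<eta> \<beta> lam j (lax_rhs \<eta> \<beta> lam i i) R \<psi>) =
    lax_defect \<eta> \<beta> lam i j R * \<psi> j
    + (\<Sum>k\<in>UNIV - {i, j}. (lam + \<eta> k (R $ k))
        * (partial_deriv j (\<beta> k i) R - \<beta> k j R * \<beta> j i R) * \<psi> k)"
proof -
  define c where "c m = lam + \<eta> m (R $ m)" for m
  define h where "h m = vector_derivative (\<eta> m) (at (R $ m))" for m
  define b where "b m l = \<beta> m l R" for m l
  define d where "d m l k = partial_deriv k (\<beta> m l) R" for m l k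
  note fold = c_def[symmetric] h_def[symmetric] b_def[symmetric] d_def[symmetric]
  have c: "c m \<noteq> 0" for m
    using adm by (simp add: c_def)
  have split_i: "(\<Sum>m\<in>UNIV - {i}. f m) = f j + (\<Sum>m\<in>UNIV - {i, j}. f m)" for f :: "'n \<Rightarrow> 'b"
    using \<open>i \<noteq> j\<close> sum.remove[of "UNIV - {i}" j f] by (simp add: Diff_insert2[symmetric] insert_commute)
  have split_j: "(\<Sum>m\<in>UNIV - {j}. f m) = f i + (\<Sum>m\<in>UNIV - {i, j}. f m)" for f :: "'n \<Rightarrow> 'b"
    using \<open>i \<noteq> j\<close> sum.remove[of "UNIV - {j}" i f] by (simp add: Diff_insert2[symmetric] insert_commute)
  have left: "total_deriv \<eta> \<beta> lam i (lax_rhs \<eta> \<beta> lam j i) R \<psi> =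
      d i j i * \<psi> j + b i j * lax_rhs \<eta> \<beta> lam i j R \<psi>"
    using \<open>i \<noteq> j\<close> \<beta> by (simp add: total_deriv_lax_rhs partial_deriv_lax_rhs_off fold)
      (simp add: lax_rhs_def fold)
  have left': "lax_rhs \<eta> \<beta> lam i j R \<psi> = b j i * \<psi> i"
    using \<open>i \<noteq> j\<close> by (simp add: lax_rhs_def fold)
  have p: "c i * partial_deriv j (\<lambda>S. lax_rhs \<eta> \<beta> lam i i S \<psi>) R =
      - (h j * b j i + c j * d j i j) * \<psi> j - (\<Sum>m\<in>UNIV - {i, j}. c m * d m i j * \<psi> m)"
  proof -
    have "(\<Sum>m\<in>UNIV - {i, j}. ((if j = m then h m else 0) * b m i + c m * d m i j) / c i * \<psi> m)
        = (\<Sum>m\<in>UNIV - {i, j}. c m * d m i j * \<psi> m) / c i"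
      unfolding sum_divide_distrib by (rule sum.cong) auto
    then have "partial_deriv j (\<lambda>S. lax_rhs \<eta> \<beta> lam i i S \<psi>) R =
        - ((h j * b j i + c j * d j i j) / c i * \<psi> j + (\<Sum>m\<in>UNIV - {i, j}. c m * d m i j * \<psi> m) / c i)"
      using partial_deriv_lax_rhs_diag[where \<beta> = \<beta> and lam = lam and \<psi> = \<psi>, OF \<open>i \<noteq> j\<close> \<eta> \<beta>]
      unfolding fold split_i by simp
    then show ?thesis
      using c[of i] by (simp add: field_simps)
  qed
  have q: "lax_rhs \<eta> \<beta> lam i i R (\<lambda>m. lax_rhs \<eta> \<beta> lam j m R \<psi>) =
      - (h i / (2 * c i)) * (b i j * \<psi> j) - c j / c i * b j i * lax_rhs \<eta> \<beta> lam j j R \<psi>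
      - (\<Sum>m\<in>UNIV - {i, j}. c m * (b m i * b m j)) / c i * \<psi> j"
  proof -
    have "(\<Sum>m\<in>UNIV - {i, j}. c m / c i * b m i * lax_rhs \<eta> \<beta> lam j m R \<psi>)
        = (\<Sum>m\<in>UNIV - {i, j}. c m * (b m i * b m j)) / c i * \<psi> j"
      unfolding sum_divide_distrib sum_distrib_right
      by (rule sum.cong) (auto simp: lax_rhs_def fold)
    moreover have "lax_rhs \<eta> \<beta> lam j i R \<psi> = b i j * \<psi> j"
      using \<open>i \<noteq> j\<close> by (simp add: lax_rhs_def fold)
    ultimately show ?thesis
      unfolding lax_rhs_def[of _ _ _ i i] fold split_i by simp
  qed
  have r: "c j * lax_rhs \<eta> \<beta> lam j j R \<psi> =
      - h j / 2 * \<psi> j - c i * b i j * \<psi> i - (\<Sum>m\<in>UNIV - {i, j}. c m * b m j * \<psi> m)"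
  proof -
    have "(\<Sum>m\<in>UNIV - {i, j}. c m / c j * b m j * \<psi> m)
        = (\<Sum>m\<in>UNIV - {i, j}. c m * b m j * \<psi> m) / c j"
      unfolding sum_divide_distrib by (rule sum.cong) auto
    then show ?thesis
      unfolding lax_rhs_def fold split_j
      using c[of j] by (simp add: field_simps)
  qed
  have s: "(\<Sum>k\<in>UNIV - {i, j}. c k * (d k i j - b k j * b j i) * \<psi> k) =
      (\<Sum>m\<in>UNIV - {i, j}. c m * d m i j * \<psi> m) - b j i * (\<Sum>m\<in>UNIV - {i, j}. c m * b m j * \<psi> m)"
    by (simp add: sum_distrib_left sum_subtractf[symmetric] algebra_simps)
  have "c i * lax_rhs \<eta> \<beta> lam i i R (\<lambda>m. lax_rhs \<eta> \<beta> lam j m R \<psi>) =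
      - (h i / 2) * (b i j * \<psi> j) - b j i * (c j * lax_rhs \<eta> \<beta> lam j j R \<psi>)
      - (\<Sum>m\<in>UNIV - {i, j}. c m * (b m i * b m j)) * \<psi> j"
    unfolding q using c[of i] by (simp add: field_simps)
  then have q': "c i * total_deriv \<eta> \<beta> lam j (lax_rhs \<eta> \<beta> lam i i) R \<psi> =
      - (h j * b j i + c j * d j i j) * \<psi> j - (\<Sum>m\<in>UNIV - {i, j}. c m * d m i j * \<psi> m)
      - (h i / 2) * (b i j * \<psi> j)
      - b j i * (- h j / 2 * \<psi> j - c i * b i j * \<psi> i - (\<Sum>m\<in>UNIV - {i, j}. c m * b m j * \<psi> m))
      - (\<Sum>m\<in>UNIV - {i, j}. c m * (b m i * b m j)) * \<psi> j"
    unfolding r total_deriv_lax_rhs distrib_left p by simp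
  show ?thesis
    unfolding lax_defect_def fold s right_diff_distrib[of "c i"] q' left left'
    by (simp add: field_simps)
qed

section \<open>Elimination of the spectral parameter\<close>

text \<open>
  Both differences computed above are linear in \<open>\<psi>\<close>, and the unit vector in direction \<open>j\<close> isolates
  the coefficient of \<open>\<psi> j\<close>. In the mixed difference the other coefficients vanish by the conditions
  that distinct \<open>i, j, k\<close> already impose.
\<close>

lemma compatible_at_iff:
  fixes \<eta> :: "'n::finite \<Rightarrow> real \<Rightarrow> 'b::real_normed_field"
  assumes \<eta>: "\<And>m. \<eta> m differentiable (at (R $ m))"
    and \<beta>: "\<And>m l. m \<noteq> l \<Longrightarrow> \<beta> m l differentiable (at R)"
    and adm: "\<And>m. lam + \<eta> m (R $ m) \<noteq> 0"
  shows "(\<forall>\<psi> i j k. total_deriv \<eta> \<beta> lam k (lax_rhs \<eta> \<beta> lam j i) R \<psi>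
            = total_deriv \<eta> \<beta> lam j (lax_rhs \<eta> \<beta> lam k i) R \<psi>) \<longleftrightarrow>
    (\<forall>i j k. i \<noteq> j \<and> j \<noteq> k \<and> i \<noteq> k \<longrightarrow> partial_deriv k (\<beta> i j) R = \<beta> i k R * \<beta> k j R)
    \<and> (\<forall>i j. i \<noteq> j \<longrightarrow> lax_defect \<eta> \<beta> lam i j R = 0)"
    (is "?C \<longleftrightarrow> ?T \<and> ?D")
proof
  assume C: ?C
  have T: "partial_deriv k (\<beta> i j) R = \<beta> i k R * \<beta> k j R"
    if "i \<noteq> j" "j \<noteq> k" "i \<noteq> k" for i j k
    using triple_difference[where \<beta> = \<beta>, OF that \<beta>[OF that(1)] \<beta>[OF that(3)],
        where \<psi> = "(\<lambda>_. 0)(j := 1)" and \<eta> = \<eta> and lam = lam] C that by simp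
  have "lax_defect \<eta> \<beta> lam i j R = 0" if "i \<noteq> j" for i j
  proof -
    have "(\<Sum>k\<in>UNIV - {i, j}. (lam + \<eta> k (R $ k))
        * (partial_deriv j (\<beta> k i) R - \<beta> k j R * \<beta> j i R) * ((\<lambda>_. 0)(j := 1)) k) = 0"
      by (rule sum.neutral) auto
    then show ?thesis
      using mixed_difference[where \<beta> = \<beta>, OF that \<eta> \<beta> adm, where \<psi> = "(\<lambda>_. 0)(j := 1)"] C by simp
  qed
  with T show "?T \<and> ?D" by blast
next
  assume TD: "?T \<and> ?D"
  have mixed: "total_deriv \<eta> \<beta> lam i (lax_rhs \<eta> \<beta> lam j i) R \<psi>
      = total_deriv \<eta> \<beta> lam j (lax_rhs \<eta> \<beta> lam i i) R \<psi>" if "i \<noteq> j" for i j \<psi>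
  proof -
    have "(\<Sum>k\<in>UNIV - {i, j}. (lam + \<eta> k (R $ k))
        * (partial_deriv j (\<beta> k i) R - \<beta> k j R * \<beta> j i R) * \<psi> k) = 0"
      using TD that by (intro sum.neutral) auto
    then show ?thesis
      using mixed_difference[where \<beta> = \<beta>, OF that \<eta> \<beta> adm, where \<psi> = \<psi>] TD that adm[of i] by simp
  qed
  show ?C
  proof (intro allI)
    fix \<psi> and i j k :: 'n
    consider "j = k" | "i = j" "j \<noteq> k" | "i = k" "j \<noteq> k" | "i \<noteq> j" "j \<noteq> k" "i \<noteq> k"
      by blast
    then show "total_deriv \<eta> \<beta> lam k (lax_rhs \<eta> \<beta> lam j i) R \<psi>
        = total_deriv \<eta> \<beta> lam j (lax_rhs \<eta> \<beta> lam k i) R \<psi>"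
    proof cases
      case 1
      then show ?thesis by simp
    next
      case 2
      then show ?thesis using mixed[of i k \<psi>] by simp
    next
      case 3
      then show ?thesis using mixed[of i j \<psi>] by simp
    next
      case 4
      then show ?thesis
        using triple_difference[where \<beta> = \<beta>, OF 4 \<beta>[OF 4(1)] \<beta>[OF 4(3)],
            where \<psi> = \<psi> and \<eta> = \<eta> and lam = lam] TD
        by simp
    qed
  qed
qed

text \<open>
  Here \<open>p\<close> and \<open>q\<close> stand for \<open>\<partial>\<^sub>i \<beta>\<^sub>i\<^sub>j\<close> and \<open>\<partial>\<^sub>j \<beta>\<^sub>j\<^sub>i\<close>, \<open>x\<close> and \<open>y\<close> for \<open>\<eta>\<^sub>i\<close> and \<open>\<eta>\<^sub>j\<close>. The vanishing of an
  affine function of \<open>l\<close> off a finite set means \<open>p + q + W = 0\<close> and \<open>x * p + y * q + h + V = 0\<close>;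
  the right-hand side is Cramer's rule.
\<close>

lemma affine_vanishes_iff:
  fixes p q x y h V W :: "'b::field_char_0"
  assumes "x \<noteq> y" and "finite F"
  shows "(\<forall>l. l \<notin> F \<longrightarrow> (l + x) * p + (l + y) * q + h + (l * W + V) = 0) \<longleftrightarrow>
    p = (h + V - y * W) / (y - x) \<and> q = (h + V - x * W) / (x - y)"
    (is "?L \<longleftrightarrow> ?R")
proof
  assume L: ?L
  obtain a where a: "a \<notin> F"
    using ex_new_if_finite[OF infinite_UNIV_char_0 \<open>finite F\<close>] by blast
  obtain b where b: "b \<notin> F" "b \<noteq> a"
    using ex_new_if_finite[OF infinite_UNIV_char_0, of "insert a F"] \<open>finite F\<close> by auto
  have E: "a * (p + q + W) + (x * p + y * q + h + V) = 0"
    "b * (p + q + W) + (x * p + y * q + h + V) = 0"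
    using L a b by (auto simp: algebra_simps)
  then have "(b - a) * (p + q + W) = 0"
    by algebra
  then have slope: "p + q + W = 0"
    using b by simp
  with E have const: "x * p + y * q + h + V = 0"
    by simp
  have "p * (y - x) = h + V - y * W" "q * (x - y) = h + V - x * W"
    using slope const by algebra+
  then show ?R
    using \<open>x \<noteq> y\<close> by (simp add: eq_divide_eq)
next
  assume ?R
  then have "p * (y - x) = h + V - y * W" "q * (x - y) = h + V - x * W"
    using \<open>x \<noteq> y\<close> by auto
  then have "(y - x) * ((l + x) * p + (l + y) * q + h + (l * W + V)) = 0" for l
    by algebra
  then show ?L
    using \<open>x \<noteq> y\<close> by simp
qed

lemma admissible_iff:
  fixes x :: "'n \<Rightarrow> 'b::group_add"
  shows "(\<forall>m. l + x m \<noteq> 0) \<longleftrightarrow> l \<notin> range (\<lambda>m. - x m)"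
  by (simp add: image_iff eq_neg_iff_add_eq_0)

lemma lax_defect_vanishes_iff:
  fixes \<eta> :: "'n::finite \<Rightarrow> real \<Rightarrow> 'b::real_normed_field"
    and \<beta> :: "'n \<Rightarrow> 'n \<Rightarrow> real^'n \<Rightarrow> 'b"
  assumes ne: "\<eta> i (R $ i) \<noteq> \<eta> j (R $ j)"
  defines "rhs \<equiv> \<lambda>i j.
      1/2 * (vector_derivative (\<eta> i) (at (R $ i)) / (\<eta> j (R $ j) - \<eta> i (R $ i))) * \<beta> i j R
      + 1/2 * (vector_derivative (\<eta> j) (at (R $ j)) / (\<eta> j (R $ j) - \<eta> i (R $ i))) * \<beta> j i R
      + (\<Sum>k\<in>UNIV - {i, j}. (\<eta> k (R $ k) - \<eta> j (R $ j)) / (\<eta> j (R $ j) - \<eta> i (R $ i))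
            * \<beta> k i R * \<beta> k j R)"
  shows "(\<forall>lam. (\<forall>m. lam + \<eta> m (R $ m) \<noteq> 0) \<longrightarrow> lax_defect \<eta> \<beta> lam i j R = 0) \<longleftrightarrow>
    partial_deriv i (\<beta> i j) R = rhs i j \<and> partial_deriv j (\<beta> j i) R = rhs j i"
proof -
  define h where "h i j = (vector_derivative (\<eta> i) (at (R $ i)) * \<beta> i j R
       + vector_derivative (\<eta> j) (at (R $ j)) * \<beta> j i R) / 2" for i j
  define V where "V i j = (\<Sum>k\<in>UNIV - {i, j}. \<eta> k (R $ k) * (\<beta> k i R * \<beta> k j R))" for i j
  define W where "W i j = (\<Sum>k\<in>UNIV - {i, j}. \<beta> k i R * \<beta> k j R)" for i j
  have sym: "h j i = h i j" "V j i = V i j" "W j i = W i j"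
    by (auto simp: h_def V_def W_def insert_commute mult_ac add_ac)
  have rhs: "rhs i j = (h i j + V i j - \<eta> j (R $ j) * W i j) / (\<eta> j (R $ j) - \<eta> i (R $ i))" for i j
  proof -
    have "(\<Sum>k\<in>UNIV - {i, j}. (\<eta> k (R $ k) - \<eta> j (R $ j)) / (\<eta> j (R $ j) - \<eta> i (R $ i))
            * \<beta> k i R * \<beta> k j R) = (V i j - \<eta> j (R $ j) * W i j) / (\<eta> j (R $ j) - \<eta> i (R $ i))"
      unfolding V_def W_def sum_distrib_left sum_subtractf[symmetric] sum_divide_distrib
      by (rule sum.cong) (auto simp: algebra_simps)
    then show ?thesis
      by (simp add: rhs_def h_def add_divide_distrib diff_divide_distrib)
  qed
  have defect: "lax_defect \<eta> \<beta> lam i j R = (lam + \<eta> i (R $ i)) * partial_deriv i (\<beta> i j) R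
      + (lam + \<eta> j (R $ j)) * partial_deriv j (\<beta> j i) R + h i j + (lam * W i j + V i j)" for lam
    by (simp add: lax_defect_def h_def V_def W_def sum_distrib_left sum.distrib distrib_right)
  have "finite (range (\<lambda>m. - \<eta> m (R $ m)))"
    by simp
  from affine_vanishes_iff[OF ne this] show ?thesis
    unfolding admissible_iff defect rhs sym .
qed

section \<open>The Lax pair\<close>

theorem mainTheorem2:
  fixes U :: "(real^'n::finite) set"
    and \<eta> :: "'n \<Rightarrow> real \<Rightarrow> 'b::real_normed_field"
    and \<beta> :: "'n \<Rightarrow> 'n \<Rightarrow> real^'n \<Rightarrow> 'b"
  assumes "open U"
    and "\<And>R i. R \<in> U \<Longrightarrow> \<eta> i differentiable (at (R $ i))"
    and "\<And>R i j. R \<in> U \<Longrightarrow> i \<noteq> j \<Longrightarrow> \<eta> i (R $ i) \<noteq> \<eta> j (R $ j)"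
    and "\<And>R i j. R \<in> U \<Longrightarrow> i \<noteq> j \<Longrightarrow> \<beta> i j differentiable (at R)"
  shows "lax_compatible U \<eta> \<beta> \<longleftrightarrow> nonlinear_system U \<eta> \<beta>"
proof -
  define T where "T R \<longleftrightarrow> (\<forall>i j k. i \<noteq> j \<and> j \<noteq> k \<and> i \<noteq> k \<longrightarrow>
    partial_deriv k (\<beta> i j) R = \<beta> i k R * \<beta> k j R)" for R
  define rhs where "rhs R i j =
      1/2 * (vector_derivative (\<eta> i) (at (R $ i)) / (\<eta> j (R $ j) - \<eta> i (R $ i))) * \<beta> i j R
      + 1/2 * (vector_derivative (\<eta> j) (at (R $ j)) / (\<eta> j (R $ j) - \<eta> i (R $ i))) * \<beta> j i R
      + (\<Sum>k\<in>UNIV - {i, j}. (\<eta> k (R $ k) - \<eta> j (R $ j)) / (\<eta> j (R $ j) - \<eta> i (R $ i))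
            * \<beta> k i R * \<beta> k j R)" for R i j
  define adm where "adm R lam \<longleftrightarrow> (\<forall>m. lam + \<eta> m (R $ m) \<noteq> 0)" for R lam
  have ex: "\<exists>lam. adm R lam" for R
    using ex_new_if_finite[OF infinite_UNIV_char_0, of "range (\<lambda>m. - \<eta> m (R $ m))"]
    by (simp add: adm_def admissible_iff)
  have "lax_compatible U \<eta> \<beta> \<longleftrightarrow>
      (\<forall>lam. \<forall>R\<in>U. adm R lam \<longrightarrow> T R \<and> (\<forall>i j. i \<noteq> j \<longrightarrow> lax_defect \<eta> \<beta> lam i j R = 0))"
    unfolding lax_compatible_def adm_def T_def
    using compatible_at_iff[where \<eta> = \<eta> and \<beta> = \<beta>, OF assms(2,4)] by (simp cong: imp_cong)
  also have "\<dots> \<longleftrightarrow> (\<forall>R\<in>U. T R \<and>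
      (\<forall>i j. i \<noteq> j \<longrightarrow> (\<forall>lam. adm R lam \<longrightarrow> lax_defect \<eta> \<beta> lam i j R = 0)))"
    using ex by blast
  also have "\<dots> \<longleftrightarrow> (\<forall>R\<in>U. T R \<and> (\<forall>i j. i \<noteq> j \<longrightarrow>
      partial_deriv i (\<beta> i j) R = rhs R i j \<and> partial_deriv j (\<beta> j i) R = rhs R j i))"
    unfolding adm_def rhs_def using lax_defect_vanishes_iff[where \<eta> = \<eta>, OF assms(3)] by (simp cong: imp_cong)
  also have "\<dots> \<longleftrightarrow> (\<forall>R\<in>U. T R \<and> (\<forall>i j. i \<noteq> j \<longrightarrow> partial_deriv i (\<beta> i j) R = rhs R i j))"
    by metis
  also have "\<dots> \<longleftrightarrow> nonlinear_system U \<eta> \<beta>"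
    unfolding nonlinear_system_def T_def rhs_def ..
  finally show ?thesis .
qed

end
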